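(* Let $M\in ARI^{\Delta}$ be alternal and push-invariant. Let $A=\Delta M$ and let $A'$ be the mould $A'(u_1,\ldots,u_r)=\frac{A(u_1,\ldots,u_r)}{u_1\cdots u_r}=(u_1+\cdots+u_r)M(u_1,\ldots,u_r)$. Let $C=(c_r)_{r\ge0}$ be a constant mould. Then the following are equivalent (for the same $C$): (i) $swapM+C$ satisfies the first alternality relation, i.e. $(swapM+C)\bigl(sh((v_1),(v_2,\ldots,v_r))\bigr)=0$ for all $r\ge2$; (ii) $swapM+C$ satisfies the circ-neutrality relation, i.e. the sum of $(swapM+C)$ over the $r$ cyclic permutations of $(v_1,\ldots,v_r)$ is $0$ for all $r\ge2$; (iii) $\mathcal{F}(A')(u_1,\ldots,u_r)=-r\,c_r\,(u_2+\cdots+u_r)$ for all $r\ge2$.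
   Context: A mould over $\mathbb{Q}$ is a family $A=(A_r)_{r\ge0}$ where $A_r=A(u_1,\ldots,u_r)$ is a rational function over $\mathbb{Q}$ in $r$ commutative variables ($A(\emptyset)$ a constant). $ARI$ is the space of moulds with $A(\emptyset)=0$. A constant mould $C=(c_r)_{r\ge0}$ has as depth $r$ value the constant $c_r$. For $r\ge1$, $\Delta A(u_1,\ldots,u_r)=u_1\cdots u_r(u_1+\cdots+u_r)A(u_1,\ldots,u_r)$; $ARI^{\Delta}$ is the subspace of $A\in ARI$ such that all components of $\Delta A$ are polynomials. $A(sh(\cdot,\cdot))$ denotes the sum of $A$ over all shuffles of the two sequences. $A$ is alternal if $A\bigl(sh((u_1,\ldots,u_i),(u_{i+1},\ldots,u_r))\bigr)=0$ for $r\ge2$, $1\le i\le r-1$. $A$ is push-invariant if $A(-u_1-\cdots-u_r,u_1,\ldots,u_{r-1})=A(u_1,\ldots,u_r)$ for all $r\ge1$. The swap is $swapA(v_1,\ldots,v_r)=A(v_r,v_{r-1}-v_r,\ldots,v_1-v_2)$. The Fay operator is $$\mathcal{F}(B)(u_1,\ldots,u_r)=B(u_1,\ldots,u_r)+B(u_2,\ldots,u_r,-\bar u_r)+\sum_{i=1}^{r-1}B(u_2,\ldots,u_i,-\bar u_i,\bar u_{i+1},u_{i+2},\ldots,u_r),\quad \bar u_i=u_1+\cdots+u_i.$$ *)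

theory Defs
  imports Complex_Main "HOL-Library.Poly_Mapping" "HOL-Computational_Algebra.Fraction_Field"
begin

(* Polynomials over the rationals in the variables X_0, X_1, X_2, ..., a monomial being its
   finitely supported exponent function, and the fraction field of this ring. Depth r components
   of moulds live in the subfield of rational functions in X_1, ..., X_r (X_0 is never used).
   The variables u_i and, after the swap, v_i are both X_i. *)

type_synonym qpoly = "(nat \<Rightarrow>\<^sub>0 nat) \<Rightarrow>\<^sub>0 rat"
type_synonym ratfun = "qpoly fract"

definition vars :: "qpoly \<Rightarrow> nat set" where
  "vars p = (\<Union>m\<in>Poly_Mapping.keys p. Poly_Mapping.keys m)"

definition of_qpoly :: "qpoly \<Rightarrow> ratfun" where
  "of_qpoly p = Fract p 1"

definition const :: "rat \<Rightarrow> ratfun" where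
  "const c = of_qpoly (Poly_Mapping.single 0 c)"

definition X :: "nat \<Rightarrow> ratfun" where
  "X i = of_qpoly (Poly_Mapping.single (Poly_Mapping.single i 1) 1)"

definition polys_in :: "nat set \<Rightarrow> ratfun set" where
  "polys_in V = {of_qpoly p |p. vars p \<subseteq> V}"

definition ratfuns_in :: "nat set \<Rightarrow> ratfun set" where
  "ratfuns_in V = {Fract p q |p q. q \<noteq> 0 \<and> vars p \<subseteq> V \<and> vars q \<subseteq> V}"

definition poly_subst :: "(nat \<Rightarrow> ratfun) \<Rightarrow> qpoly \<Rightarrow> ratfun" where
  "poly_subst \<sigma> p =
     (\<Sum>m\<in>Poly_Mapping.keys p. const (Poly_Mapping.lookup p m)
        * (\<Prod>i\<in>Poly_Mapping.keys m. \<sigma> i ^ Poly_Mapping.lookup m i))"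

(* The value is meaningful as soon as f has some representation p/q whose denominator does not
   vanish under the substitution, and then it does not depend on the representation
   (rat_subst_Fract below). *)
definition rat_subst :: "(nat \<Rightarrow> ratfun) \<Rightarrow> ratfun \<Rightarrow> ratfun" where
  "rat_subst \<sigma> f = (THE y. \<exists>p q. q \<noteq> 0 \<and> f = Fract p q \<and> poly_subst \<sigma> q \<noteq> 0 \<and>
     y = poly_subst \<sigma> p / poly_subst \<sigma> q)"


type_synonym mould = "nat \<Rightarrow> ratfun"

definition is_mould :: "mould \<Rightarrow> bool" where
  "is_mould A \<longleftrightarrow> (\<forall>r. A r \<in> ratfuns_in {1..r})"

(* A(x_1, ..., x_r) for a list of rational functions x_1, ..., x_r *)
definition mould_app :: "mould \<Rightarrow> ratfun list \<Rightarrow> ratfun" where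
  "mould_app A xs =
     rat_subst (\<lambda>i. if 1 \<le> i \<and> i \<le> length xs then xs ! (i - 1) else X i) (A (length xs))"

definition mould_add :: "mould \<Rightarrow> mould \<Rightarrow> mould" where
  "mould_add A B = (\<lambda>r. A r + B r)"

definition const_mould :: "(nat \<Rightarrow> rat) \<Rightarrow> mould" where
  "const_mould c = (\<lambda>r. const (c r))"

definition ARI :: "mould set" where
  "ARI = {A. is_mould A \<and> A 0 = 0}"

definition Delta :: "mould \<Rightarrow> mould" where
  "Delta A r = (if r = 0 then A 0 else (\<Prod>i=1..r. X i) * (\<Sum>i=1..r. X i) * A r)"

definition ARI_Delta :: "mould set" where
  "ARI_Delta = {A \<in> ARI. \<forall>r. Delta A r \<in> polys_in {1..r}}"

definition depth_div :: "mould \<Rightarrow> mould" where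
  "depth_div A r = A r / (\<Prod>i=1..r. X i)"

(* A(sh((X_i)_{i in is}, (X_j)_{j in js})). In all uses the indices in is @ js are distinct, so
   that the set of shuffles lists every shuffle exactly once. *)
definition mould_sh :: "mould \<Rightarrow> nat list \<Rightarrow> nat list \<Rightarrow> ratfun" where
  "mould_sh A is js = (\<Sum>ks\<in>shuffles is js. mould_app A (map X ks))"

definition alternal :: "mould \<Rightarrow> bool" where
  "alternal A \<longleftrightarrow> (\<forall>r\<ge>2. \<forall>i\<in>{1..r - 1}. mould_sh A [1..<i + 1] [i + 1..<r + 1] = 0)"

definition first_alternality :: "mould \<Rightarrow> bool" where
  "first_alternality A \<longleftrightarrow> (\<forall>r\<ge>2. mould_sh A [1] [2..<r + 1] = 0)"

definition circ_neutral :: "mould \<Rightarrow> bool" where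
  "circ_neutral A \<longleftrightarrow> (\<forall>r\<ge>2. (\<Sum>k<r. mould_app A (map X (rotate k [1..<r + 1]))) = 0)"

definition push_invariant :: "mould \<Rightarrow> bool" where
  "push_invariant A \<longleftrightarrow> (\<forall>r\<ge>1. mould_app A ((- (\<Sum>i=1..r. X i)) # map X [1..<r]) = A r)"

definition swap :: "mould \<Rightarrow> mould" where
  "swap A r = (if r = 0 then A 0
     else mould_app A (X r # map (\<lambda>i. X i - X (i + 1)) (rev [1..<r])))"

definition ubar :: "nat \<Rightarrow> ratfun" where
  "ubar i = (\<Sum>j=1..i. X j)"

(* The defining formula is used for r >= 1 only; the value at r = 0 is a convention. *)
definition fay :: "mould \<Rightarrow> mould" where
  "fay B r = (if r = 0 then B 0 else
     B r + mould_app B (map X [2..<r + 1] @ [- ubar r])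
     + (\<Sum>i=1..r - 1.
          mould_app B (map X [2..<i + 1] @ [- ubar i, ubar (i + 1)] @ map X [i + 2..<r + 1])))"


lemma of_qpoly_0 [simp]: "of_qpoly 0 = 0"
  by (simp add: of_qpoly_def Zero_fract_def)

lemma of_qpoly_1 [simp]: "of_qpoly 1 = 1"
  by (simp add: of_qpoly_def One_fract_def)

lemma of_qpoly_add: "of_qpoly (p + q) = of_qpoly p + of_qpoly q"
  by (simp add: of_qpoly_def)

lemma of_qpoly_mult: "of_qpoly (p * q) = of_qpoly p * of_qpoly q"
  by (simp add: of_qpoly_def)

lemma of_qpoly_sum: "of_qpoly (\<Sum>i\<in>I. f i) = (\<Sum>i\<in>I. of_qpoly (f i))"
  by (induction I rule: infinite_finite_induct) (simp_all add: of_qpoly_add)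

lemma of_qpoly_prod: "of_qpoly (\<Prod>i\<in>I. f i) = (\<Prod>i\<in>I. of_qpoly (f i))"
  by (induction I rule: infinite_finite_induct) (simp_all add: of_qpoly_mult)

lemma of_qpoly_power: "of_qpoly (p ^ n) = of_qpoly p ^ n"
  by (induction n) (simp_all add: of_qpoly_mult)

lemma of_qpoly_eq_iff [simp]: "of_qpoly p = of_qpoly q \<longleftrightarrow> p = q"
  by (simp add: of_qpoly_def eq_fract)

lemma const_0 [simp]: "const 0 = 0"
  by (simp add: const_def)

lemma const_1 [simp]: "const 1 = 1"
  by (simp add: const_def)

lemma const_add: "const (a + b) = const a + const b"
  by (simp add: const_def single_add of_qpoly_add)

lemma const_mult: "const (a * b) = const a * const b"
  by (simp add: const_def flip: of_qpoly_mult) (simp add: mult_single)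

definition mon_subst :: "(nat \<Rightarrow> ratfun) \<Rightarrow> (nat \<Rightarrow>\<^sub>0 nat) \<Rightarrow> ratfun" where
  "mon_subst \<sigma> m = (\<Prod>i\<in>Poly_Mapping.keys m. \<sigma> i ^ Poly_Mapping.lookup m i)"

lemma mon_subst_superset:
  assumes "finite S" "Poly_Mapping.keys m \<subseteq> S"
  shows "mon_subst \<sigma> m = (\<Prod>i\<in>S. \<sigma> i ^ Poly_Mapping.lookup m i)"
  unfolding mon_subst_def
  by (rule prod.mono_neutral_left) (use assms in \<open>auto simp: in_keys_iff\<close>)

lemma mon_subst_add: "mon_subst \<sigma> (m + n) = mon_subst \<sigma> m * mon_subst \<sigma> n"
proof -
  let ?S = "Poly_Mapping.keys m \<union> Poly_Mapping.keys n"
  have "mon_subst \<sigma> (m + n) = (\<Prod>i\<in>?S. \<sigma> i ^ Poly_Mapping.lookup (m + n) i)"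
    by (rule mon_subst_superset) (simp_all add: Poly_Mapping.keys_add)
  also have "\<dots> = (\<Prod>i\<in>?S. \<sigma> i ^ Poly_Mapping.lookup m i) * (\<Prod>i\<in>?S. \<sigma> i ^ Poly_Mapping.lookup n i)"
    by (simp add: lookup_add power_add prod.distrib)
  also have "\<dots> = mon_subst \<sigma> m * mon_subst \<sigma> n"
    by (simp add: mon_subst_superset[of ?S])
  finally show ?thesis .
qed

lemma poly_subst_alt:
  "poly_subst \<sigma> p = (\<Sum>m\<in>Poly_Mapping.keys p. const (Poly_Mapping.lookup p m) * mon_subst \<sigma> m)"
  by (simp add: poly_subst_def mon_subst_def)

lemma poly_subst_0 [simp]: "poly_subst \<sigma> 0 = 0"
  by (simp add: poly_subst_def)

lemma poly_subst_add: "poly_subst \<sigma> (p + q) = poly_subst \<sigma> p + poly_subst \<sigma> q"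
  unfolding poly_subst_alt
  by (rule setsum_keys_plus_distrib) (simp_all add: const_add distrib_right)

lemma poly_subst_single: "poly_subst \<sigma> (Poly_Mapping.single m c) = const c * mon_subst \<sigma> m"
  by (simp add: poly_subst_alt)

lemma poly_subst_sum: "poly_subst \<sigma> (\<Sum>i\<in>I. f i) = (\<Sum>i\<in>I. poly_subst \<sigma> (f i))"
  by (induction I rule: infinite_finite_induct) (simp_all add: poly_subst_add)

lemma qpoly_sum_monomials:
  "p = (\<Sum>m\<in>Poly_Mapping.keys p. Poly_Mapping.single m (Poly_Mapping.lookup p m))" for p :: qpoly
  by (rule poly_mapping_eqI)
     (auto simp: lookup_sum lookup_single when_def in_keys_iff)

lemma poly_subst_mult: "poly_subst \<sigma> (p * q) = poly_subst \<sigma> p * poly_subst \<sigma> q"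
proof -
  let ?P = "Poly_Mapping.keys p" and ?Q = "Poly_Mapping.keys q"
  have "p * q = (\<Sum>m\<in>?P. \<Sum>n\<in>?Q. Poly_Mapping.single (m + n)
                   (Poly_Mapping.lookup p m * Poly_Mapping.lookup q n))"
    using arg_cong2[OF qpoly_sum_monomials[of p] qpoly_sum_monomials[of q], of "(*)"]
    by (simp add: sum_product mult_single)
  then have "poly_subst \<sigma> (p * q) = (\<Sum>m\<in>?P. \<Sum>n\<in>?Q.
      const (Poly_Mapping.lookup p m) * mon_subst \<sigma> m
      * (const (Poly_Mapping.lookup q n) * mon_subst \<sigma> n))"
    by (simp add: poly_subst_sum poly_subst_single const_mult mon_subst_add mult_ac)
  then show ?thesis
    by (simp add: poly_subst_alt sum_product)
qed

lemma rat_subst_Fract: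
  assumes "poly_subst \<sigma> q \<noteq> 0"
  shows "rat_subst \<sigma> (Fract p q) = poly_subst \<sigma> p / poly_subst \<sigma> q"
  unfolding rat_subst_def
proof (rule the_equality)
  have "q \<noteq> 0"
    using assms by auto
  then show "\<exists>p' q'. q' \<noteq> 0 \<and> Fract p q = Fract p' q' \<and> poly_subst \<sigma> q' \<noteq> 0 \<and>
      poly_subst \<sigma> p / poly_subst \<sigma> q = poly_subst \<sigma> p' / poly_subst \<sigma> q'"
    using assms by blast
  fix y
  assume "\<exists>p' q'. q' \<noteq> 0 \<and> Fract p q = Fract p' q' \<and> poly_subst \<sigma> q' \<noteq> 0 \<and>
    y = poly_subst \<sigma> p' / poly_subst \<sigma> q'"
  then obtain p' q' where *: "q' \<noteq> 0" "Fract p q = Fract p' q'" "poly_subst \<sigma> q' \<noteq> 0"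
    and y: "y = poly_subst \<sigma> p' / poly_subst \<sigma> q'"
    by blast
  from * \<open>q \<noteq> 0\<close> have "p * q' = p' * q"
    by (simp add: eq_fract)
  then have "poly_subst \<sigma> p * poly_subst \<sigma> q' = poly_subst \<sigma> p' * poly_subst \<sigma> q"
    by (simp flip: poly_subst_mult)
  then show "y = poly_subst \<sigma> p / poly_subst \<sigma> q"
    using assms * y by (simp add: frac_eq_eq)
qed

lemma single_power_X: "Poly_Mapping.single (Poly_Mapping.single i 1) 1 ^ n =
    (Poly_Mapping.single (Poly_Mapping.single i n) 1 :: qpoly)"
  by (induction n) (simp_all add: mult_single single_add[symmetric])

lemma prod_single_1: "finite I \<Longrightarrow>
    (\<Prod>i\<in>I. Poly_Mapping.single (f i) 1) = (Poly_Mapping.single (\<Sum>i\<in>I. f i) 1 :: qpoly)"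
  by (induction I rule: finite_induct) (simp_all add: mult_single)

lemma mon_subst_X: "mon_subst X m = of_qpoly (Poly_Mapping.single m 1)"
proof -
  have m: "(\<Sum>i\<in>Poly_Mapping.keys m. Poly_Mapping.single i (Poly_Mapping.lookup m i)) = m"
    by (rule poly_mapping_eqI) (auto simp: lookup_sum lookup_single when_def in_keys_iff)
  show ?thesis
    by (simp add: mon_subst_def X_def m prod_single_1 single_power_X[simplified]
        flip: of_qpoly_power of_qpoly_prod)
qed

lemma poly_subst_X: "poly_subst X p = of_qpoly p"
proof -
  have "poly_subst X p = (\<Sum>m\<in>Poly_Mapping.keys p.
      of_qpoly (Poly_Mapping.single m (Poly_Mapping.lookup p m)))"
    by (simp add: poly_subst_alt mon_subst_X const_def flip: of_qpoly_mult) (simp add: mult_single)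
  also have "\<dots> = of_qpoly p"
    by (subst (4) qpoly_sum_monomials) (simp add: of_qpoly_sum)
  finally show ?thesis .
qed

lemma rat_subst_X: "rat_subst X f = f"
proof (cases f)
  case (Fract p q)
  then have "of_qpoly q \<noteq> of_qpoly 0"
    unfolding of_qpoly_eq_iff by simp
  then show ?thesis
    using Fract by (simp add: rat_subst_Fract poly_subst_X) (simp add: of_qpoly_def)
qed

lemma mould_app_X: "mould_app A (map X [1..<r + 1]) = A r"
proof -
  have "(\<lambda>i. if 1 \<le> i \<and> i \<le> r then map X [1..<r + 1] ! (i - 1) else X i) = X"
    by (rule ext) (auto simp del: upt_Suc)
  then show ?thesis
    unfolding mould_app_def by (simp add: rat_subst_X del: upt_Suc One_nat_def)
qed

lemma X_neq_0 [simp]: "X i \<noteq> 0"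
proof -
  have "X i \<noteq> of_qpoly 0"
    unfolding X_def of_qpoly_eq_iff by (metis single_zero inj_single injD lookup_single_eq lookup_zero zero_neq_one)
  then show ?thesis by simp
qed

lemma depth_div_Delta:
  assumes "M \<in> ARI"
  shows "depth_div (Delta M) r = (\<Sum>i=1..r. X i) * M r"
  using assms by (auto simp: depth_div_def Delta_def ARI_def)

end

theory Submission
  imports Defs
begin

text \<open>
  Write the arguments of \<open>M\<close> as successive differences of points \<open>p\<^sub>0, \<dots>, p\<^sub>r\<close>. Then push-invariance says
  that the value depends only on the cyclic word of the points, and alternality implies that
  reversing the arguments multiplies the value by \<open>(-1)\<^bsup>r - 1\<^esup>\<close>. Up to this sign, the first
  alternality sum of \<open>swap M\<close> is the sum \<open>T\<close> over all insertions of \<open>v\<^sub>1\<close> into the cyclic word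
  \<open>(v\<^sub>2, \<dots>, v\<^sub>r, 0)\<close>, and the circ-neutrality sum is the sum over all insertions of \<open>0\<close> into
  \<open>(v\<^sub>1, \<dots>, v\<^sub>r)\<close>. Translation invariance lets one exchange \<open>v\<^sub>1\<close> and \<open>0\<close> by a linear change of
  variables, and constants are not affected by it. In the variables \<open>v\<^sub>i = u\<^sub>i + \<dots> + u\<^sub>r\<close> the
  summands of \<open>T\<close> are those of the Fay operator, in which the factor \<open>u\<^sub>1 + \<dots> + u\<^sub>r\<close> of \<open>A'\<close> becomes
  \<open>u\<^sub>2 + \<dots> + u\<^sub>r\<close>. The remaining sign \<open>(-1)\<^bsup>r - 1\<^esup>\<close> between \<open>T\<close> and the alternality sum disappears
  because reversing and negating all points multiplies \<open>T\<close> by it, so that the sign is 1 if \<open>T\<close> is a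
  nonzero constant.
\<close>

subsection \<open>Generic substitutions\<close>

text \<open>On this subring \<open>rat_subst\<close> is a ring homomorphism for every substitution,
  since the denominator can be taken to be 1. On all of \<open>ratfun\<close> this is shown for
  generic substitutions.\<close>

definition polys :: "ratfun set" where
  "polys = range of_qpoly"

lemma of_qpoly_in_polys [simp]: "of_qpoly p \<in> polys"
  by (simp add: polys_def)

lemma polysE: assumes "f \<in> polys" obtains p where "f = of_qpoly p"
  using assms by (auto simp: polys_def)

lemma of_qpoly_uminus: "of_qpoly (- p) = - of_qpoly p"
  by (simp add: of_qpoly_def)

lemma poly_subst_1 [simp]: "poly_subst \<sigma> 1 = 1"
  using poly_subst_single[of \<sigma> 0 1] by (simp add: mon_subst_def)

lemma poly_subst_uminus: "poly_subst \<sigma> (- p) = - poly_subst \<sigma> p"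
  using poly_subst_add[of \<sigma> p "- p"] by (simp add: eq_neg_iff_add_eq_0 add.commute)

lemma rat_subst_of_qpoly: "rat_subst \<sigma> (of_qpoly p) = poly_subst \<sigma> p"
  by (simp add: of_qpoly_def rat_subst_Fract)

lemma X_in_polys [simp]: "X i \<in> polys"
  by (simp add: X_def)

lemma const_in_polys [simp]: "const c \<in> polys"
  by (simp add: const_def)

lemma zero_in_polys [simp]: "0 \<in> polys"
  using of_qpoly_in_polys[of 0] by simp

lemma one_in_polys [simp]: "1 \<in> polys"
  using of_qpoly_in_polys[of 1] by simp

lemma uminus_in_polys [simp]: "a \<in> polys \<Longrightarrow> - a \<in> polys"
  by (metis polysE of_qpoly_in_polys of_qpoly_uminus)

lemma add_in_polys [simp]: "a \<in> polys \<Longrightarrow> b \<in> polys \<Longrightarrow> a + b \<in> polys"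
  by (metis polysE of_qpoly_in_polys of_qpoly_add)

lemma diff_in_polys [simp]: "a \<in> polys \<Longrightarrow> b \<in> polys \<Longrightarrow> a - b \<in> polys"
  using add_in_polys[of a "- b"] by simp

lemma mult_in_polys [simp]: "a \<in> polys \<Longrightarrow> b \<in> polys \<Longrightarrow> a * b \<in> polys"
  by (metis polysE of_qpoly_in_polys of_qpoly_mult)

lemma power_in_polys [simp]: "a \<in> polys \<Longrightarrow> a ^ n \<in> polys"
  by (induction n) simp_all

lemma sum_in_polys [simp]: "(\<And>i. i \<in> I \<Longrightarrow> f i \<in> polys) \<Longrightarrow> sum f I \<in> polys"
  by (induction I rule: infinite_finite_induct) simp_all

lemma prod_in_polys [simp]: "(\<And>i. i \<in> I \<Longrightarrow> f i \<in> polys) \<Longrightarrow> prod f I \<in> polys"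
  by (induction I rule: infinite_finite_induct) simp_all

lemma poly_subst_in_polys: "(\<And>i. \<sigma> i \<in> polys) \<Longrightarrow> poly_subst \<sigma> p \<in> polys"
  by (simp add: poly_subst_def)

lemma rat_subst_in_polys: "(\<And>i. \<sigma> i \<in> polys) \<Longrightarrow> a \<in> polys \<Longrightarrow> rat_subst \<sigma> a \<in> polys"
  by (metis polysE rat_subst_of_qpoly poly_subst_in_polys)

lemma rat_subst_const [simp]: "rat_subst \<sigma> (const c) = const c"
  by (simp add: const_def rat_subst_of_qpoly poly_subst_single mon_subst_def)

lemma rat_subst_0 [simp]: "rat_subst \<sigma> 0 = 0"
  using rat_subst_const[of \<sigma> 0] by simp

lemma rat_subst_1 [simp]: "rat_subst \<sigma> 1 = 1"
  using rat_subst_const[of \<sigma> 1] by simp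

lemma rat_subst_var [simp]: "rat_subst \<sigma> (X i) = \<sigma> i"
  by (simp add: X_def rat_subst_of_qpoly poly_subst_single mon_subst_def)

lemma rat_subst_poly_add:
  "a \<in> polys \<Longrightarrow> b \<in> polys \<Longrightarrow> rat_subst \<sigma> (a + b) = rat_subst \<sigma> a + rat_subst \<sigma> b"
  by (auto elim!: polysE simp: rat_subst_of_qpoly poly_subst_add simp flip: of_qpoly_add)

lemma rat_subst_poly_uminus: "a \<in> polys \<Longrightarrow> rat_subst \<sigma> (- a) = - rat_subst \<sigma> a"
  by (auto elim!: polysE simp: rat_subst_of_qpoly poly_subst_uminus simp flip: of_qpoly_uminus)

lemma rat_subst_poly_diff:
  "a \<in> polys \<Longrightarrow> b \<in> polys \<Longrightarrow> rat_subst \<sigma> (a - b) = rat_subst \<sigma> a - rat_subst \<sigma> b"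
  using rat_subst_poly_add[of a "- b" \<sigma>] by (simp add: rat_subst_poly_uminus)

lemma rat_subst_poly_mult:
  "a \<in> polys \<Longrightarrow> b \<in> polys \<Longrightarrow> rat_subst \<sigma> (a * b) = rat_subst \<sigma> a * rat_subst \<sigma> b"
  by (auto elim!: polysE simp: rat_subst_of_qpoly poly_subst_mult simp flip: of_qpoly_mult)

lemma rat_subst_poly_power: "a \<in> polys \<Longrightarrow> rat_subst \<sigma> (a ^ n) = rat_subst \<sigma> a ^ n"
  by (induction n) (simp_all add: rat_subst_poly_mult)

lemma rat_subst_poly_sum:
  "(\<And>i. i \<in> I \<Longrightarrow> f i \<in> polys) \<Longrightarrow> rat_subst \<sigma> (sum f I) = (\<Sum>i\<in>I. rat_subst \<sigma> (f i))"
  by (induction I rule: infinite_finite_induct) (simp_all add: rat_subst_poly_add)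

lemma rat_subst_poly_prod:
  "(\<And>i. i \<in> I \<Longrightarrow> f i \<in> polys) \<Longrightarrow> rat_subst \<sigma> (prod f I) = (\<Prod>i\<in>I. rat_subst \<sigma> (f i))"
  by (induction I rule: infinite_finite_induct) (simp_all add: rat_subst_poly_mult)

lemma rat_subst_poly_subst:
  assumes "\<And>i. \<sigma> i \<in> polys"
  shows "rat_subst \<tau> (poly_subst \<sigma> p) = poly_subst (\<lambda>i. rat_subst \<tau> (\<sigma> i)) p"
  using assms
  by (simp add: poly_subst_def rat_subst_poly_sum rat_subst_poly_mult rat_subst_poly_prod
      rat_subst_poly_power)

text \<open>Algebraically independent polynomials: no denominator vanishes under such a substitution.\<close>
definition generic :: "(nat \<Rightarrow> ratfun) \<Rightarrow> bool" where
  "generic \<sigma> \<longleftrightarrow> (\<forall>i. \<sigma> i \<in> polys) \<and> (\<forall>q. q \<noteq> 0 \<longrightarrow> poly_subst \<sigma> q \<noteq> 0)"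

text \<open>A left inverse \<open>\<tau>\<close> certifies algebraic independence: applied to a
  relation \<open>q\<close> between the \<open>\<sigma> i\<close>, it returns \<open>q\<close>
  itself.\<close>

lemma genericI:
  assumes "\<And>i. \<sigma> i \<in> polys" and "\<And>i. rat_subst \<tau> (\<sigma> i) = X i"
  shows "generic \<sigma>"
  unfolding generic_def
proof (intro conjI allI impI notI)
  fix q :: qpoly assume "q \<noteq> 0" "poly_subst \<sigma> q = 0"
  have "of_qpoly q = rat_subst \<tau> (poly_subst \<sigma> q)"
    using assms by (simp add: rat_subst_poly_subst poly_subst_X[symmetric])
  then show False
    using \<open>q \<noteq> 0\<close> \<open>poly_subst \<sigma> q = 0\<close> of_qpoly_eq_iff[of q 0] by simp
qed (rule assms)

lemma rat_subst_generic_Fract: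
  "generic \<sigma> \<Longrightarrow> q \<noteq> 0 \<Longrightarrow> rat_subst \<sigma> (Fract p q) = poly_subst \<sigma> p / poly_subst \<sigma> q"
  by (simp add: generic_def rat_subst_Fract)

lemma rat_subst_add:
  assumes "generic \<sigma>"
  shows "rat_subst \<sigma> (f + g) = rat_subst \<sigma> f + rat_subst \<sigma> g"
proof (cases f, cases g)
  fix a b c d :: qpoly
  assume "f = Fract a b" "b \<noteq> 0" "g = Fract c d" "d \<noteq> 0"
  moreover from this have "poly_subst \<sigma> b \<noteq> 0" "poly_subst \<sigma> d \<noteq> 0"
    using assms by (auto simp: generic_def)
  ultimately show ?thesis
    using assms
    by (simp add: rat_subst_generic_Fract poly_subst_add poly_subst_mult add_frac_eq)
qed

lemma rat_subst_mult:
  assumes "generic \<sigma>"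
  shows "rat_subst \<sigma> (f * g) = rat_subst \<sigma> f * rat_subst \<sigma> g"
proof (cases f, cases g)
  fix a b c d :: qpoly
  assume "f = Fract a b" "b \<noteq> 0" "g = Fract c d" "d \<noteq> 0"
  then show ?thesis
    using assms by (simp add: rat_subst_generic_Fract poly_subst_mult)
qed

lemma rat_subst_sum:
  "generic \<sigma> \<Longrightarrow> rat_subst \<sigma> (sum f I) = (\<Sum>i\<in>I. rat_subst \<sigma> (f i))"
  by (induction I rule: infinite_finite_induct) (simp_all add: rat_subst_add)

lemma rat_subst_eq_0_iff: "generic \<sigma> \<Longrightarrow> rat_subst \<sigma> f = 0 \<longleftrightarrow> f = 0"
proof (cases f)
  case (Fract p q)
  moreover assume \<sigma>: "generic \<sigma>"
  ultimately have "rat_subst \<sigma> f = 0 \<longleftrightarrow> p = 0"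
    by (auto simp: rat_subst_generic_Fract generic_def)
  also have "\<dots> \<longleftrightarrow> f = 0"
    using Fract by (simp add: Zero_fract_def eq_fract)
  finally show ?thesis .
qed

text \<open>A generic substitution is injective, so an identity may be carried through it in both
  directions.\<close>

lemma rat_subst_eq_iff:
  assumes "generic \<sigma>"
  shows "rat_subst \<sigma> f = rat_subst \<sigma> g \<longleftrightarrow> f = g"
  using rat_subst_eq_0_iff[OF assms, of "f - g"] rat_subst_add[OF assms, of "f - g" g] by simp

lemma generic_comp:
  assumes "generic \<sigma>" "generic \<tau>"
  shows "generic (\<lambda>i. rat_subst \<tau> (\<sigma> i))"
  unfolding generic_def
proof (intro conjI allI impI)
  show "rat_subst \<tau> (\<sigma> i) \<in> polys" for i
    using assms by (auto simp: generic_def intro: rat_subst_in_polys)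
  fix q :: qpoly assume "q \<noteq> 0"
  then have "rat_subst \<tau> (poly_subst \<sigma> q) \<noteq> 0"
    using assms by (simp add: rat_subst_eq_0_iff) (simp add: generic_def)
  then show "poly_subst (\<lambda>i. rat_subst \<tau> (\<sigma> i)) q \<noteq> 0"
    using assms by (simp add: rat_subst_poly_subst generic_def)
qed

lemma rat_subst_comp:
  assumes "generic \<sigma>" "generic \<tau>"
  shows "rat_subst \<tau> (rat_subst \<sigma> f) = rat_subst (\<lambda>i. rat_subst \<tau> (\<sigma> i)) f"
proof (cases f)
  case (Fract p q)
  then have q: "poly_subst \<sigma> q \<noteq> 0"
    using assms by (simp add: generic_def)
  let ?g = "poly_subst \<sigma> p / poly_subst \<sigma> q"
  \<comment> \<open>The image of a quotient is determined by multiplicativity, as the image of its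
    denominator is nonzero.\<close>
  have "rat_subst \<tau> ?g * rat_subst \<tau> (poly_subst \<sigma> q) = rat_subst \<tau> (poly_subst \<sigma> p)"
    using q by (simp flip: rat_subst_mult[OF assms(2)])
  moreover have "rat_subst \<tau> (poly_subst \<sigma> q) \<noteq> 0"
    using q assms by (simp add: rat_subst_eq_0_iff)
  ultimately have "rat_subst \<tau> ?g = rat_subst \<tau> (poly_subst \<sigma> p) / rat_subst \<tau> (poly_subst \<sigma> q)"
    by (simp add: eq_divide_eq)
  then show ?thesis
    using assms Fract
    by (simp add: rat_subst_generic_Fract generic_comp rat_subst_poly_subst generic_def[of \<sigma>])
qed

section \<open>Substitution of argument lists into moulds\<close>

definition list_subst :: "ratfun list \<Rightarrow> nat \<Rightarrow> ratfun" where
  "list_subst xs i = (if 1 \<le> i \<and> i \<le> length xs then xs ! (i - 1) else X i)"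

lemma mould_app_alt: "mould_app A xs = rat_subst (list_subst xs) (A (length xs))"
  by (simp add: mould_app_def list_subst_def[abs_def])

lemma list_subst_in_polys: "set xs \<subseteq> polys \<Longrightarrow> list_subst xs i \<in> polys"
  by (auto simp: list_subst_def)

lemma map_list_subst:
  "length xs = r \<Longrightarrow> map (list_subst xs) [1..<r + 1] = xs"
  by (rule nth_equalityI) (auto simp: list_subst_def simp del: upt_Suc)

lemma list_subst_map:
  "1 \<le> i \<Longrightarrow> i \<le> r \<Longrightarrow> list_subst (map f [1..<r + 1]) i = f i"
  by (simp add: list_subst_def del: upt_Suc)

abbreviation generic_args :: "ratfun list \<Rightarrow> bool" where
  "generic_args xs \<equiv> generic (list_subst xs)"

text \<open>The list \<open>ys\<close> is a left inverse. Having the same length, both lists fix the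
  same remaining variables, so only the listed entries need checking.\<close>

lemma generic_argsI:
  assumes "set xs \<subseteq> polys" "length ys = length xs"
    and "map (rat_subst (list_subst ys)) xs = map X [1..<length xs + 1]"
  shows "generic_args xs"
proof (rule genericI)
  show "list_subst xs i \<in> polys" for i
    using assms(1) by (rule list_subst_in_polys)
  show "rat_subst (list_subst ys) (list_subst xs i) = X i" for i
  proof (cases "1 \<le> i \<and> i \<le> length xs")
    case True
    then have "map (rat_subst (list_subst ys)) xs ! (i - 1) = map X [1..<length xs + 1] ! (i - 1)"
      using assms(3) by simp
    moreover have "i - 1 < length xs" "1 + (i - 1) = i"
      using True by auto
    ultimately show ?thesis
      using True by (simp add: list_subst_def del: upt_Suc One_nat_def)
  next
    case False
    then show ?thesis
      using assms(2) by (auto simp: list_subst_def)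
  qed
qed

lemma list_subst_comp:
  assumes "length ys = length xs"
  shows "(\<lambda>i. rat_subst (list_subst ys) (list_subst xs i))
    = list_subst (map (rat_subst (list_subst ys)) xs)"
  using assms by (intro ext) (auto simp: list_subst_def)

lemma generic_args_comp:
  assumes "generic_args xs" "generic_args ys" "length ys = length xs"
  shows "generic_args (map (rat_subst (list_subst ys)) xs)"
  using generic_comp[OF assms(1,2)] by (simp add: list_subst_comp assms(3))

lemma rat_subst_mould_app:
  assumes "generic_args xs" "generic_args ys" "length ys = length xs"
  shows "rat_subst (list_subst ys) (mould_app A xs)
    = mould_app A (map (rat_subst (list_subst ys)) xs)"
  using rat_subst_comp[OF assms(1,2)] by (simp add: mould_app_alt list_subst_comp assms(3))

lemma generic_args_mapI:
  assumes "\<And>i. 1 \<le> i \<Longrightarrow> i \<le> r \<Longrightarrow> f i \<in> polys" "length ys = r"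
    and "\<And>i. 1 \<le> i \<Longrightarrow> i \<le> r \<Longrightarrow> rat_subst (list_subst ys) (f i) = X i"
  shows "generic_args (map f [1..<r + 1])"
  by (rule generic_argsI[where ys = ys]) (use assms in \<open>auto simp del: upt_Suc\<close>)

subsection \<open>Alternality and reversal\<close>

text \<open>Since \<open>shuffles\<close> yields a set, different first letters are what makes its
  recursion a disjoint union.\<close>

lemma sum_shuffles_Cons:
  assumes "x \<noteq> y"
  shows "sum f (shuffles (x # xs) (y # ys))
    = (\<Sum>zs\<in>shuffles xs (y # ys). f (x # zs)) + (\<Sum>zs\<in>shuffles (x # xs) ys. f (y # zs))"
proof -
  have "(#) x ` shuffles xs (y # ys) \<inter> (#) y ` shuffles (x # xs) ys = {}"
    using assms by auto
  then show ?thesis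
    by (simp add: sum.union_disjoint sum.reindex)
qed

lemma shuffles_map: "shuffles (map f xs) (map f ys) = map f ` shuffles xs ys"
  by (induction xs ys rule: shuffles.induct) (simp_all add: image_Un image_image)

lemma sum_shuffles_singleton:
  "x \<notin> set ys \<Longrightarrow>
    sum f (shuffles [x] ys) = (\<Sum>j<Suc (length ys). f (take j ys @ [x] @ drop j ys))"
proof (induction ys arbitrary: f)
  case (Cons y ys)
  then have "sum f (shuffles [x] (y # ys)) = f (x # y # ys)
      + (\<Sum>j<Suc (length ys). f (y # take j ys @ [x] @ drop j ys))"
    by (simp add: sum_shuffles_Cons del: shuffles.simps(3) sum.lessThan_Suc)
  then show ?case
    by (subst sum.lessThan_Suc_shift) simp
qed simp

text \<open>Induction on \<open>ys\<close>: the vanishing shuffle sum of \<open>x # xs\<close> and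
  \<open>y # ys\<close>, split by its first letter, trades the front letter \<open>x\<close> for
  \<open>y\<close> at the cost of a sign. The case \<open>xs = []\<close> is the reversal
  formula.\<close>

lemma sum_shuffles_antipode:
  fixes f :: "'a list \<Rightarrow> 'b :: ring_1"
  assumes "\<And>as bs. as \<noteq> [] \<Longrightarrow> bs \<noteq> [] \<Longrightarrow> distinct (as @ bs) \<Longrightarrow> set (as @ bs) = S
      \<Longrightarrow> sum f (shuffles as bs) = 0"
    and "distinct (x # xs @ ys)" "set (x # xs @ ys) = S"
  shows "(\<Sum>zs\<in>shuffles xs ys. f (x # zs)) = (- 1) ^ length ys * f (rev ys @ x # xs)"
  using assms(2,3)
proof (induction ys arbitrary: x xs)
  case (Cons y ys)
  have "sum f (shuffles (x # xs) (y # ys)) = 0"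
    using Cons.prems by (intro assms(1)) auto
  moreover have "x \<noteq> y"
    using Cons.prems by auto
  ultimately have "(\<Sum>zs\<in>shuffles xs (y # ys). f (x # zs))
      = - (\<Sum>zs\<in>shuffles (x # xs) ys. f (y # zs))"
    by (metis sum_shuffles_Cons eq_neg_iff_add_eq_0)
  also have "(\<Sum>zs\<in>shuffles (x # xs) ys. f (y # zs)) = (- 1) ^ length ys * f (rev ys @ y # x # xs)"
    using Cons.prems by (intro Cons.IH) auto
  finally show ?case
    by simp
qed simp

lemma generic_args_permutation:
  assumes "distinct w" "set w = {1..length w}"
  shows "generic_args (map X w)"
proof -
  \<comment> \<open>The inverse permutation, counted from 0; the \<open>Suc\<close> below turns
    positions into indices of variables.\<close>
  define pos where "pos k = inv_into {..<length w} ((!) w) k" for k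
  have bij: "bij_betw ((!) w) {..<length w} {1..length w}"
    using assms bij_betw_nth[of w "{..<length w}" "{1..length w}"] by simp
  have pos: "pos (w ! j) = j" if "j < length w" for j
    using bij_betw_inv_into_left[OF bij] that by (simp add: pos_def)
  have w: "1 \<le> w ! j \<and> w ! j \<le> length w" if "j < length w" for j
    using assms(2) that nth_mem by fastforce
  show ?thesis
    by (rule generic_argsI[where ys = "map (\<lambda>k. X (Suc (pos k))) [1..<length w + 1]"])
      (auto intro!: nth_equalityI simp: list_subst_map w pos plus_1_eq_Suc simp del: upt_Suc One_nat_def)
qed

lemma mould_app_map_X:
  assumes "generic_args xs" "generic_args (map X ks)" "length xs = length ks"
  shows "rat_subst (list_subst xs) (mould_app A (map X ks)) = mould_app A (map (list_subst xs) ks)"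
  using rat_subst_mould_app[OF assms(2,1)] assms(3) by (simp add: comp_def)

text \<open>The definition of \<open>alternal\<close> concerns consecutive blocks of variables;
  renaming variable \<open>i\<close> to letter \<open>i\<close> of \<open>as @ bs\<close> carries it
  to arbitrary blocks.\<close>

lemma alternal_permutation:
  assumes "alternal M" "as \<noteq> []" "bs \<noteq> []" "distinct (as @ bs)" "set (as @ bs) = {1..r}"
  shows "(\<Sum>ks\<in>shuffles as bs. mould_app M (map X ks)) = 0"
proof -
  define i where "i = length as"
  define w where "w = as @ bs"
  define f where "f j = w ! (j - 1)" for j
  have w: "distinct w" "set w = {1..length w}" and r: "length w = r"
    using assms(4,5) distinct_card[of "as @ bs"] by (simp_all add: w_def)
  have i: "1 \<le> i" "i < r"
    using assms(2,3) r by (auto simp: i_def w_def Suc_le_eq)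
  have gen: "generic_args (map X w)"
    by (rule generic_args_permutation) fact+
  let ?L = "[1..<i + 1]" and ?R = "[i + 1..<r + 1]"
  have as: "as = map f ?L" and bs: "bs = map f ?R"
    using r by (auto intro!: nth_equalityI simp: f_def i_def w_def nth_append simp del: upt_Suc)
  have inj: "inj_on f {1..r}"
    using w(1) r by (auto simp: inj_on_def f_def nth_eq_iff_index_eq)
  have perm: "distinct ks \<and> set ks = {1..r} \<and> length ks = r" if "ks \<in> shuffles ?L ?R" for ks
  proof -
    have "distinct ks"
      using that by (intro distinct_disjoint_shuffles[OF _ _ _ that]) auto
    moreover have "set ks = {1..r}"
      unfolding set_shuffles[OF that] using i by auto
    moreover have "length ks = r"
      unfolding length_shuffles[OF that] using i by simp
    ultimately show ?thesis by simp
  qed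
  have "inj_on (map f) (shuffles ?L ?R)"
    using inj perm by (intro inj_onI) (metis map_inj_on sup.idem)
  then have "(\<Sum>ks\<in>shuffles as bs. mould_app M (map X ks))
      = (\<Sum>ks\<in>shuffles ?L ?R. mould_app M (map X (map f ks)))"
    by (simp add: as bs shuffles_map sum.reindex del: upt_Suc)
  also have "\<dots> = (\<Sum>ks\<in>shuffles ?L ?R. rat_subst (list_subst (map X w)) (mould_app M (map X ks)))"
  proof (intro sum.cong refl)
    fix ks assume "ks \<in> shuffles ?L ?R"
    then have ks: "distinct ks" "set ks = {1..r}" "length ks = r"
      using perm by auto
    then have "rat_subst (list_subst (map X w)) (mould_app M (map X ks))
        = mould_app M (map (list_subst (map X w)) ks)"
      using r by (intro mould_app_map_X gen generic_args_permutation) simp_all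
    also have "map (list_subst (map X w)) ks = map X (map f ks)"
      using ks r by (auto simp: list_subst_def f_def)
    finally show "mould_app M (map X (map f ks))
        = rat_subst (list_subst (map X w)) (mould_app M (map X ks))" by simp
  qed
  also have "\<dots> = rat_subst (list_subst (map X w)) (mould_sh M ?L ?R)"
    by (simp add: mould_sh_def rat_subst_sum[OF gen])
  also have "mould_sh M ?L ?R = 0"
    using assms(1)[unfolded alternal_def, rule_format, of r i] i by simp
  finally show ?thesis
    by simp
qed

lemma generic_args_X: "generic_args (map X [1..<r + 1])"
  by (rule generic_args_permutation) (auto simp del: upt_Suc)

lemma rat_subst_sign_mult:
  "generic \<sigma> \<Longrightarrow> rat_subst \<sigma> ((- 1) ^ n * f) = (- 1) ^ n * rat_subst \<sigma> f"
  by (simp add: rat_subst_mult rat_subst_poly_power rat_subst_poly_uminus)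

lemma alternal_rev:
  assumes "alternal M" "generic_args xs" "xs \<noteq> []"
  shows "mould_app M (rev xs) = (- 1) ^ (length xs - 1) * mould_app M xs"
    and "generic_args (rev xs)"
proof -
  define r where "r = length xs"
  have r: "r \<ge> 1"
    using assms(3) by (simp add: r_def Suc_le_eq)
  then have upt: "[1..<r + 1] = 1 # [2..<r + 1]"
    using upt_conv_Cons[of 1 "r + 1"] by (simp add: numeral_2_eq_2)
  have gen: "generic_args (map X (rev [1..<r + 1]))"
    by (rule generic_args_permutation) (auto simp del: upt_Suc)
  \<comment> \<open>The antipode identity with front letter 1 and an empty first factor, where the
    only shuffle is the word 2, ..., r.\<close>
  have "(\<Sum>zs\<in>shuffles [] [2..<r + 1]. mould_app M (map X (1 # zs)))
      = (- 1) ^ length [2..<r + 1] * mould_app M (map X (rev [2..<r + 1] @ 1 # []))"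
    using r by (intro sum_shuffles_antipode[where S = "{1..r}"] alternal_permutation[OF assms(1)])
      (auto simp del: upt_Suc)
  then have "mould_app M (map X [1..<r + 1]) = (- 1) ^ (r - 1) * mould_app M (map X (rev [1..<r + 1]))"
    unfolding upt by (simp del: upt_Suc)
  then have "rat_subst (list_subst xs) (mould_app M (map X [1..<r + 1]))
      = (- 1) ^ (r - 1) * rat_subst (list_subst xs) (mould_app M (map X (rev [1..<r + 1])))"
    by (simp add: rat_subst_sign_mult[OF assms(2)] del: upt_Suc)
  then have *: "mould_app M (map (list_subst xs) [1..<r + 1])
      = (- 1) ^ (r - 1) * mould_app M (map (list_subst xs) (rev [1..<r + 1]))"
    using mould_app_map_X[OF assms(2) generic_args_X[of r], of M] mould_app_map_X[OF assms(2) gen, of M]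
    by (simp add: r_def del: upt_Suc)
  have map_rev: "map (list_subst xs) (rev [1..<r + 1]) = rev xs"
    using map_list_subst[of xs r] by (simp add: r_def rev_map[symmetric] del: upt_Suc)
  show "mould_app M (rev xs) = (- 1) ^ (length xs - 1) * mould_app M xs"
    using * map_list_subst[of xs r] map_rev
    by (simp add: r_def minus_one_power_iff del: upt_Suc)
  show "generic_args (rev xs)"
    using generic_args_comp[OF gen assms(2)] map_rev by (simp add: r_def comp_def del: upt_Suc)
qed

subsection \<open>Push-invariance as a cyclic symmetry\<close>

definition steps :: "ratfun list \<Rightarrow> ratfun list" where
  "steps ps = map2 (-) ps (tl ps)"

lemma steps_Nil [simp]: "steps [] = []"
  and steps_single [simp]: "steps [p] = []"
  and steps_Cons2 [simp]: "steps (p # q # ps) = (p - q) # steps (q # ps)"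
  by (simp_all add: steps_def)

lemma length_steps [simp]: "length (steps ps) = length ps - 1"
  by (simp add: steps_def)

lemma steps_eq_Nil_iff: "steps ps = [] \<longleftrightarrow> length ps \<le> 1"
  by (simp flip: length_0_conv)

lemma steps_append: "steps (ps @ q # qs) = steps (ps @ [q]) @ steps (q # qs)"
proof (induction ps)
  case (Cons p ps)
  then show ?case by (cases ps) simp_all
qed simp

lemma steps_snoc2: "steps (ps @ [p, q]) = steps (ps @ [p]) @ [p - q]"
  using steps_append[of ps p "[q]"] by simp

lemma map_steps:
  "set ps \<subseteq> polys \<Longrightarrow> map (rat_subst \<sigma>) (steps ps) = steps (map (rat_subst \<sigma>) ps)"
  by (induction ps rule: induct_list012) (simp_all add: rat_subst_poly_diff)

lemma steps_translate: "steps (map (\<lambda>p. p - c) ps) = steps ps"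
  by (induction ps rule: induct_list012) simp_all

text \<open>Reversing the points and negating them each change the sign of every difference, so
  together they only reverse the order.\<close>

lemma steps_reflect: "steps (map uminus (rev ps)) = rev (steps ps)"
  by (induction ps rule: induct_list012) (simp_all add: steps_snoc2)

lemma steps_map_upt: "steps (map q [a..<Suc (a + n)]) = map (\<lambda>i. q i - q (Suc i)) [a..<a + n]"
proof (induction n)
  case (Suc n)
  then show ?case
    using steps_snoc2[of "map q [a..<a + n]" "q (a + n)" "q (Suc (a + n))"] by simp
qed simp

lemma sum_list_steps: "ps \<noteq> [] \<Longrightarrow> sum_list (steps ps) = hd ps - last ps"
  by (induction ps rule: induct_list012) simp_all

lemma generic_args_push:
  assumes "r \<ge> 1"
  shows "generic_args ((- (\<Sum>i=1..r. X i)) # map X [1..<r])"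
proof (rule generic_argsI)
  \<comment> \<open>The inverse of the push: it drops the first argument and appends minus the
    sum.\<close>
  define ys where "ys = map X [2..<r + 1] @ [- (\<Sum>i=1..r. X i)]"
  show "length ys = length ((- (\<Sum>i=1..r. X i)) # map X [1..<r])"
    using assms by (simp add: ys_def del: upt_Suc)
  show "set ((- (\<Sum>i=1..r. X i)) # map X [1..<r]) \<subseteq> polys"
    by auto
  have subst: "list_subst ys i = (if i = r then - (\<Sum>i=1..r. X i) else X (Suc i))"
    if "1 \<le> i" "i \<le> r" for i
    using that by (auto simp: ys_def list_subst_def nth_append simp del: upt_Suc)
  have "(\<Sum>i=1..r. list_subst ys i) = (\<Sum>i\<in>{1..<r}. X (Suc i)) - (\<Sum>i=1..r. X i)"
  proof -
    have "{1..r} = insert r {1..<r}"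
      using assms by auto
    then have "(\<Sum>i=1..r. list_subst ys i)
        = list_subst ys r + (\<Sum>i\<in>{1..<r}. list_subst ys i)"
      by simp
    also have "(\<Sum>i\<in>{1..<r}. list_subst ys i) = (\<Sum>i\<in>{1..<r}. X (Suc i))"
      by (intro sum.cong refl) (simp add: subst del: upt_Suc)
    finally show ?thesis
      using assms by (simp add: subst del: upt_Suc)
  qed
  moreover have "(\<Sum>i=1..r. X i) = X 1 + (\<Sum>i\<in>{1..<r}. X (Suc i))"
    using assms by (simp add: sum.atLeast_Suc_atMost sum.atLeast_Suc_atMost_Suc_shift
        atLeastLessThanSuc_atLeastAtMost flip: sum.shift_bounds_Suc_ivl)
  ultimately have sum: "(\<Sum>i=1..r. list_subst ys i) = - X 1"
    by simp
  have "map (rat_subst (list_subst ys)) (map X [1..<r]) = map X [2..<r + 1]"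
    by (rule nth_equalityI) (auto simp: subst simp del: upt_Suc)
  moreover have "[1..<r + 1] = 1 # [2..<r + 1]"
    using assms upt_conv_Cons[of 1 "r + 1"] by (simp add: numeral_2_eq_2)
  ultimately show "map (rat_subst (list_subst ys)) ((- (\<Sum>i=1..r. X i)) # map X [1..<r])
      = map X [1..<length ((- (\<Sum>i=1..r. X i)) # map X [1..<r]) + 1]"
    using assms sum
    by (simp add: rat_subst_poly_uminus rat_subst_poly_sum del: upt_Suc)
qed

lemma push_invariant_args:
  assumes "push_invariant M" "generic_args xs" "xs \<noteq> []"
  shows "mould_app M ((- sum_list xs) # butlast xs) = mould_app M xs"
    and "generic_args ((- sum_list xs) # butlast xs)"
proof -
  define r where "r = length xs"
  have r: "r \<ge> 1"
    using assms(3) by (simp add: r_def Suc_le_eq)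
  let ?P = "(- (\<Sum>i=1..r. X i)) # map X [1..<r]"
  have "(\<Sum>i=1..r. list_subst xs i) = sum_list (map (list_subst xs) [1..<r + 1])"
    by (simp add: sum_list_distinct_conv_sum_set atLeastLessThanSuc_atLeastAtMost del: upt_Suc)
  then have "map (rat_subst (list_subst xs)) ?P = (- sum_list xs) # map (list_subst xs) [1..<r]"
    using map_list_subst[of xs r]
    by (simp add: rat_subst_poly_uminus rat_subst_poly_sum r_def del: upt_Suc)
  moreover have "map (list_subst xs) [1..<r] = butlast xs"
    by (rule nth_equalityI) (auto simp: list_subst_def r_def nth_butlast)
  ultimately have map: "map (rat_subst (list_subst xs)) ?P = (- sum_list xs) # butlast xs"
    by (simp add: comp_def)
  have "mould_app M ?P = M r"
    using assms(1) r by (simp add: push_invariant_def)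
  then have "rat_subst (list_subst xs) (mould_app M ?P) = mould_app M xs"
    by (simp add: mould_app_alt[of M xs] r_def)
  then show "mould_app M ((- sum_list xs) # butlast xs) = mould_app M xs"
    using rat_subst_mould_app[OF generic_args_push[OF r] assms(2), of M] r
    unfolding map by (simp add: r_def)
  show "generic_args ((- sum_list xs) # butlast xs)"
    using generic_args_comp[OF generic_args_push[OF r] assms(2)] r
    unfolding map by (simp add: r_def)
qed

text \<open>One push moves the last point to the front, so the points of \<open>qs\<close> are moved
  one at a time, starting from the right. Genericity is carried along because every push requires
  it.\<close>

lemma push_invariant_rotate:
  assumes "push_invariant M" "generic_args (steps (ps @ qs))" "length (ps @ qs) \<ge> 2"
  shows "mould_app M (steps (qs @ ps)) = mould_app M (steps (ps @ qs))
    \<and> generic_args (steps (qs @ ps))"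
  using assms(2,3)
proof (induction qs arbitrary: ps rule: rev_induct)
  case (snoc q qs)
  let ?xs = "steps (ps @ qs @ [q])"
  have ne: "ps @ qs \<noteq> []"
    using snoc.prems(2) by auto
  then have "?xs \<noteq> []"
    using length_steps[of "ps @ qs @ [q]"] by force
  \<comment> \<open>The sum telescopes, so the argument that the push prepends is the difference of
    \<open>q\<close> and the first point.\<close>
  have "(- sum_list ?xs) # butlast ?xs = steps (q # ps @ qs)"
  proof -
    obtain zs z where zs: "ps @ qs = zs @ [z]"
      using ne by (metis rev_exhaust)
    then have "butlast ?xs = steps (ps @ qs)"
      using steps_snoc2[of zs z q] by (metis append.assoc append_Cons append_Nil butlast_snoc)
    moreover have "sum_list ?xs = hd (ps @ qs) - q"
      using ne sum_list_steps[of "(ps @ qs) @ [q]"] by (simp add: hd_append)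
    ultimately show ?thesis
      using ne by (cases "ps @ qs") simp_all
  qed
  then have "mould_app M (steps (q # ps @ qs)) = mould_app M ?xs"
    "generic_args (steps (q # ps @ qs))"
    using push_invariant_args[OF assms(1), of ?xs] \<open>?xs \<noteq> []\<close> snoc.prems(1) by simp_all
  then show ?case
    using snoc.IH[of "q # ps"] ne by (simp add: Suc_le_eq)
qed simp

subsection \<open>The alternality and circ-neutrality sums\<close>

lemma ubar_0 [simp]: "ubar 0 = 0"
  and ubar_Suc: "ubar (Suc i) = ubar i + X (Suc i)"
  by (simp_all add: ubar_def)

lemma ubar_in_polys [simp]: "ubar i \<in> polys"
  by (simp add: ubar_def)

text \<open>The value 0 at index \<open>r + 1\<close> is the final point, which gives the last step
  \<open>X r\<close> the same form as the others.\<close>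

definition point :: "nat \<Rightarrow> nat \<Rightarrow> ratfun" where
  "point r i = (if i \<le> r then X i else 0)"

lemma map_point: "map (point r) [1..<Suc (1 + r)] = map X [1..<r + 1] @ [0]"
  by (simp add: point_def)

lemma steps_X: "steps (map X [1..<r + 1] @ [0]) = map (\<lambda>i. point r i - point r (Suc i)) [1..<r + 1]"
  using steps_map_upt[of "point r" 1 r] unfolding map_point by (simp only: add.commute)

text \<open>Entry \<open>i\<close> is \<open>u_i + ... + u_r\<close>. This change of variables is
  inverse to taking the steps of the points \<open>v_1, ..., v_r, 0\<close>.\<close>

definition tails :: "nat \<Rightarrow> ratfun list" where
  "tails r = map (\<lambda>i. ubar r - ubar (i - 1)) [1..<r + 1]"

lemma list_subst_tails: "1 \<le> i \<Longrightarrow> i \<le> r \<Longrightarrow> list_subst (tails r) i = ubar r - ubar (i - 1)"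
  unfolding tails_def by (rule list_subst_map)

lemma generic_args_steps_X: "generic_args (steps (map X [1..<r + 1] @ [0]))"
  unfolding steps_X
proof (rule generic_args_mapI[where ys = "tails r"])
  \<comment> \<open>The range includes \<open>Suc r\<close>, where both sides are 0.\<close>
  have subst: "rat_subst (list_subst (tails r)) (point r i) = ubar r - ubar (i - 1)"
    if "1 \<le> i" "i \<le> Suc r" for i
    using that by (auto simp: point_def list_subst_tails le_Suc_eq)
  show "rat_subst (list_subst (tails r)) (point r i - point r (Suc i)) = X i"
    if "1 \<le> i" "i \<le> r" for i
  proof -
    have "rat_subst (list_subst (tails r)) (point r i - point r (Suc i))
        = (ubar r - ubar (i - 1)) - (ubar r - ubar i)"
      using that by (subst rat_subst_poly_diff) (simp_all add: subst, simp_all add: point_def)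
    with that show ?thesis
      using ubar_Suc[of "i - 1"] by simp
  qed
qed (simp_all add: tails_def point_def)

lemma generic_args_tails: "generic_args (tails r)"
proof -
  define d where "d = map (\<lambda>i. point r i - point r (Suc i)) [1..<r + 1]"
  have subst: "rat_subst (list_subst d) (ubar k) = point r 1 - point r (Suc k)" if "k \<le> r" for k
    using that
  proof (induction k)
    case (Suc k)
    moreover have "list_subst d (Suc k) = point r (Suc k) - point r (Suc (Suc k))"
      unfolding d_def using Suc.prems by (subst list_subst_map) simp_all
    ultimately show ?case
      by (simp add: ubar_Suc rat_subst_poly_add)
  qed simp
  have "rat_subst (list_subst d) (ubar r - ubar (i - 1)) = X i" if "1 \<le> i" "i \<le> r" for i
    using that by (subst rat_subst_poly_diff) (simp_all add: subst, simp add: point_def)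
  then show ?thesis
    unfolding tails_def by (intro generic_args_mapI[where ys = d]) (simp_all add: d_def)
qed

text \<open>Up to sign, this is the value of the swap of a mould at a permutation of the variables
  (\<open>swap_permutation\<close>); the final point 0 makes push-invariance a cyclic symmetry.\<close>
definition cyc :: "mould \<Rightarrow> nat list \<Rightarrow> ratfun" where
  "cyc M ks = mould_app M (steps (map X ks @ [0]))"

text \<open>The word \<open>ks\<close> is a relabelling of 1, ..., r, whose steps are generic; the
  substitution then acts on each point and fixes the final 0.\<close>

lemma rat_subst_cyc:
  assumes "distinct ks" "set ks = {1..r}" "generic_args xs" "length xs = r"
  shows "rat_subst (list_subst xs) (cyc M ks) = mould_app M (steps (map (list_subst xs) ks @ [0]))"
    and "generic_args (steps (map (list_subst xs) ks @ [0]))"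
proof -
  have len: "length ks = r"
    using distinct_card[OF assms(1)] assms(2) by simp
  have gen: "generic_args (steps (map X ks @ [0]))
      \<and> cyc M ks = rat_subst (list_subst (map X ks)) (cyc M [1..<r + 1])"
  proof -
    have "generic_args (map X ks)"
      using assms(1,2) len by (intro generic_args_permutation) auto
    moreover have "map (rat_subst (list_subst (map X ks))) (steps (map X [1..<r + 1] @ [0]))
        = steps (map X ks @ [0])"
      using map_list_subst[of "map X ks" r] len
      by (subst map_steps) (auto simp: comp_def simp del: upt_Suc)
    ultimately show ?thesis
      using generic_args_comp[OF generic_args_steps_X, of "map X ks" r]
        rat_subst_mould_app[OF generic_args_steps_X, of "map X ks" r M] len
      by (simp add: cyc_def del: upt_Suc)
  qed
  have map: "map (rat_subst (list_subst xs)) (steps (map X ks @ [0]))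
      = steps (map (list_subst xs) ks @ [0])"
    by (subst map_steps) (auto simp: comp_def)
  show "rat_subst (list_subst xs) (cyc M ks) = mould_app M (steps (map (list_subst xs) ks @ [0]))"
    using rat_subst_mould_app[of "steps (map X ks @ [0])" xs M] gen assms len
    by (simp add: map cyc_def)
  show "generic_args (steps (map (list_subst xs) ks @ [0]))"
    using generic_args_comp[of "steps (map X ks @ [0])" xs] gen assms len
    by (simp add: map)
qed

lemma generic_args_cyc:
  assumes "distinct ks" "set ks = {1..r}"
  shows "generic_args (steps (map X ks @ [0]))"
proof -
  have "map (list_subst (map X [1..<r + 1])) ks = map X ks"
    using assms(2) by (intro map_cong refl list_subst_map) auto
  from this[symmetric] show ?thesis
    by (simp only:) (rule rat_subst_cyc(2)[OF assms generic_args_X], simp)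
qed

text \<open>The arguments of the swap are the steps of \<open>v_1, ..., v_r, 0\<close> in reverse
  order, so alternality supplies the sign.\<close>

lemma swap_eq_cyc:
  assumes "alternal M" "r \<ge> 1"
  shows "swap M r = (- 1) ^ (r - 1) * cyc M [1..<r + 1]"
proof -
  have "steps (map X [1..<r + 1] @ [0]) = map (\<lambda>i. X i - X (i + 1)) [1..<r] @ [X r]"
    unfolding steps_X using assms(2) by (simp add: point_def)
  then have "X r # map (\<lambda>i. X i - X (i + 1)) (rev [1..<r]) = rev (steps (map X [1..<r + 1] @ [0]))"
    by (simp add: rev_map)
  moreover have "steps (map X [1..<r + 1] @ [0]) \<noteq> []"
    unfolding steps_X using assms(2) by simp
  ultimately show ?thesis
    using alternal_rev(1)[OF assms(1) generic_args_steps_X, of r] assms(2)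
    by (simp add: swap_def cyc_def del: upt_Suc)
qed

lemma swap_permutation:
  assumes "alternal M" "r \<ge> 1" "distinct ks" "set ks = {1..r}"
  shows "mould_app (swap M) (map X ks) = (- 1) ^ (r - 1) * cyc M ks"
proof -
  have len: "length ks = r"
    using distinct_card[OF assms(3)] assms(4) by simp
  have gen: "generic_args (map X ks)"
    using assms(3,4) len by (intro generic_args_permutation) auto
  have "rat_subst (list_subst (map X ks)) (cyc M [1..<r + 1]) = cyc M ks"
    using rat_subst_cyc(1)[OF _ _ gen, of "[1..<r + 1]" r M] map_list_subst[of "map X ks" r] len
    by (simp add: cyc_def atLeastLessThanSuc_atLeastAtMost del: upt_Suc)
  then show ?thesis
    using assms(1,2) len
    by (simp add: mould_app_alt swap_eq_cyc rat_subst_sign_mult[OF gen] del: upt_Suc)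
qed

section \<open>Both relations as conditions on sums of \<open>cyc\<close>\<close>

lemma mould_app_add_const:
  "generic_args xs \<Longrightarrow>
    mould_app (mould_add A (const_mould c)) xs = mould_app A xs + const (c (length xs))"
  by (simp add: mould_app_alt mould_add_def const_mould_def rat_subst_add)

text \<open>Serves both relations: each sums over \<open>r\<close> permutations of the variables,
  which share one sign and each contribute \<open>c_r\<close>.\<close>

lemma sum_swap_const:
  assumes "alternal M" "r \<ge> 1"
    and "\<And>j. j < r \<Longrightarrow> distinct (w j) \<and> set (w j) = {1..r}"
  shows "(\<Sum>j<r. mould_app (mould_add (swap M) (const_mould c)) (map X (w j)))
    = (- 1) ^ (r - 1) * (\<Sum>j<r. cyc M (w j)) + of_nat r * const (c r)"
proof -
  have "mould_app (mould_add (swap M) (const_mould c)) (map X (w j))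
      = (- 1) ^ (r - 1) * cyc M (w j) + const (c r)" if "j < r" for j
  proof -
    have "distinct (w j)" "set (w j) = {1..r}" "length (w j) = r"
      using assms(3)[OF that] distinct_card[of "w j"] by auto
    then show ?thesis
      using assms(1,2) by (simp add: mould_app_add_const generic_args_permutation swap_permutation)
  qed
  then show ?thesis
    by (simp add: sum.distrib sum_distrib_left)
qed

text \<open>For \<open>j < r\<close> these are the shuffles of (1) with (2, ..., r), indexed by the
  number of letters before 1.\<close>

definition word :: "nat \<Rightarrow> nat \<Rightarrow> nat list" where
  "word r j = [2..<j + 2] @ 1 # [j + 2..<r + 1]"

lemma word_permutation: "j < r \<Longrightarrow> distinct (word r j) \<and> set (word r j) = {1..r}"
  by (auto simp: word_def simp del: upt_Suc)

lemma mould_sh_singleton: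
  assumes "r \<ge> 1"
  shows "mould_sh A [1] [2..<r + 1] = (\<Sum>j<r. mould_app A (map X (word r j)))"
proof -
  have "mould_sh A [1] [2..<r + 1]
      = (\<Sum>j<Suc (r - 1). mould_app A (map X (take j [2..<r + 1] @ [1] @ drop j [2..<r + 1])))"
    unfolding mould_sh_def
    by (subst sum_shuffles_singleton) (simp_all del: upt_Suc sum.lessThan_Suc)
  also have "\<dots> = (\<Sum>j<r. mould_app A (map X (word r j)))"
    using assms by (intro sum.cong) (auto simp: word_def take_upt drop_upt simp del: upt_Suc)
  finally show ?thesis .
qed

lemma first_alternality_iff:
  assumes "alternal M"
  shows "first_alternality (mould_add (swap M) (const_mould c))
    \<longleftrightarrow> (\<forall>r\<ge>2. (- 1) ^ (r - 1) * (\<Sum>j<r. cyc M (word r j)) = - (of_nat r * const (c r)))"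
proof -
  have "mould_sh (mould_add (swap M) (const_mould c)) [1] [2..<r + 1]
    = (- 1) ^ (r - 1) * (\<Sum>j<r. cyc M (word r j)) + of_nat r * const (c r)" if "r \<ge> 2" for r
    using that sum_swap_const[OF assms _ word_permutation, where r = r and c = c]
    by (subst mould_sh_singleton) simp_all
  then show ?thesis
    by (simp add: first_alternality_def eq_neg_iff_add_eq_0 del: upt_Suc)
qed

lemma circ_neutral_iff:
  assumes "alternal M"
  shows "circ_neutral (mould_add (swap M) (const_mould c))
    \<longleftrightarrow> (\<forall>r\<ge>2. (- 1) ^ (r - 1) * (\<Sum>k<r. cyc M (rotate k [1..<r + 1])) = - (of_nat r * const (c r)))"
proof -
  have "(\<Sum>k<r. mould_app (mould_add (swap M) (const_mould c)) (map X (rotate k [1..<r + 1])))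
    = (- 1) ^ (r - 1) * (\<Sum>k<r. cyc M (rotate k [1..<r + 1])) + of_nat r * const (c r)"
    if "r \<ge> 2" for r
    using that by (intro sum_swap_const[OF assms]) (auto simp del: upt_Suc)
  then show ?thesis
    by (simp add: circ_neutral_def eq_neg_iff_add_eq_0 del: upt_Suc)
qed

text \<open>The involution exchanging the points 0 and \<open>X 1\<close> up to translation turns the insertions of
  \<open>X 1\<close> into a cyclic word into the insertions of 0.\<close>
lemma circ_sum_eq:
  assumes "push_invariant M" "r \<ge> 1"
  obtains xs where "generic_args xs"
    "rat_subst (list_subst xs) (\<Sum>j<r. cyc M (word r j)) = (\<Sum>k<r. cyc M (rotate k [1..<r + 1]))"
proof -
  let ?Y = "X(1 := 0)"
  \<comment> \<open>\<open>?Y\<close> puts 0 in place of \<open>X 1\<close>, and the translation by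
    \<open>X 1\<close> makes the final point 0 stand for \<open>X 1\<close>. The resulting
    substitution is its own inverse.\<close>
  define xs where "xs = map (\<lambda>i. ?Y i - X 1) [1..<r + 1]"
  have subst: "list_subst xs i = ?Y i - X 1" if "1 \<le> i" "i \<le> r" for i
    unfolding xs_def using that by (rule list_subst_map)
  have gen: "generic_args xs"
    unfolding xs_def
  proof (rule generic_args_mapI[where ys = xs])
    show "rat_subst (list_subst xs) (?Y i - X 1) = X i" if "1 \<le> i" "i \<le> r" for i
      using that assms(2) by (subst rat_subst_poly_diff) (simp_all add: subst)
  qed (simp_all add: xs_def)
  have len_xs: "length xs = r"
    by (simp add: xs_def)
  have step: "rat_subst (list_subst xs) (cyc M (word r j)) = cyc M (rotate (Suc j) [1..<r + 1])"
    if "j < r" for j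
  proof -
    \<comment> \<open>The cyclic word is cut right after the point 0, so that exchanging the two
      pieces puts 0 last again.\<close>
    let ?ps = "map X [2..<j + 2] @ [0]" and ?qs = "map X [j + 2..<r + 1] @ [X 1]"
    have w: "distinct (word r j)" "set (word r j) = {1..r}"
      using word_permutation[OF that] by auto
    have "map (list_subst xs) (word r j) @ [0] = map (\<lambda>p. p - X 1) (map ?Y (word r j) @ [X 1])"
      using w(2) subst by (auto simp del: upt_Suc)
    also have "map ?Y (word r j) @ [X 1] = ?ps @ ?qs"
      by (auto simp: word_def simp del: upt_Suc)
    finally have steps: "steps (map (list_subst xs) (word r j) @ [0]) = steps (?ps @ ?qs)"
      by (simp only: steps_translate)
    have rot: "rotate (Suc j) [1..<r + 1] = [j + 2..<r + 1] @ 1 # [2..<j + 2]"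
    proof -
      have "[1..<r + 1] = [1..<j + 2] @ [j + 2..<r + 1]"
        using that upt_add_eq_append[of 1 "j + 2" "r - Suc j"] by simp
      then show ?thesis
        using rotate_append[of "[1..<j + 2]" "[j + 2..<r + 1]"] upt_conv_Cons[of 1 "j + 2"]
        by (simp add: numeral_2_eq_2 del: upt_Suc)
    qed
    have cyc: "rat_subst (list_subst xs) (cyc M (word r j)) = mould_app M (steps (?ps @ ?qs))"
      and "generic_args (steps (?ps @ ?qs))"
      using rat_subst_cyc(1)[OF w gen len_xs, of M] rat_subst_cyc(2)[OF w gen len_xs]
      by (simp_all only: steps)
    then have "mould_app M (steps (?qs @ ?ps)) = mould_app M (steps (?ps @ ?qs))"
      using push_invariant_rotate[OF assms(1), of ?ps ?qs] by simp
    moreover have "?qs @ ?ps = map X (rotate (Suc j) [1..<r + 1]) @ [0]"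
      unfolding rot by (simp del: upt_Suc)
    ultimately show ?thesis
      by (simp only: cyc cyc_def[of M "rotate (Suc j) [1..<r + 1]"])
  qed
  have "rat_subst (list_subst xs) (\<Sum>j<r. cyc M (word r j))
      = (\<Sum>j<r. cyc M (rotate (Suc j) [1..<r + 1]))"
    by (simp add: rat_subst_sum[OF gen] step del: rotate_Suc upt_Suc)
  also have "\<dots> = (\<Sum>k<r. cyc M (rotate k [1..<r + 1]))"
  proof -
    \<comment> \<open>The rotations by 1, ..., r are those by 0, ..., r - 1, since rotating by
      \<open>r\<close> is the identity.\<close>
    let ?g = "\<lambda>k. cyc M (rotate k [1..<r + 1])"
    have "?g 0 + (\<Sum>j<r. ?g (Suc j)) = (\<Sum>k<r. ?g k) + ?g r"
      by (rule trans[OF sum.lessThan_Suc_shift[symmetric] sum.lessThan_Suc])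
    moreover have "?g r = ?g 0"
      using rotate_id[of r "[1..<r + 1]"] by (simp del: upt_Suc)
    ultimately show ?thesis
      by simp
  qed
  finally show thesis
    by (rule that[OF gen])
qed

text \<open>This symmetry forces the sum to vanish if it is constant and \<open>r\<close> is even.\<close>
lemma insertion_sum_reflect:
  assumes "alternal M" "push_invariant M" "r \<ge> 1"
  obtains xs where "generic_args xs"
    "rat_subst (list_subst xs) (\<Sum>j<r. cyc M (word r j))
      = (- 1) ^ (r - 1) * (\<Sum>j<r. cyc M (word r j))"
proof -
  \<comment> \<open>Fixes 1 and reverses 2, ..., r. Hence it sends an insertion after
    \<open>j\<close> letters to the reverse of the insertion after \<open>r - 1 - j\<close>
    letters.\<close>
  define f where "f i = (if i = 1 then 1 else r + 2 - i)" for i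
  define xs where "xs = map (\<lambda>i. - X (f i)) [1..<r + 1]"
  have subst: "list_subst xs i = - X (f i)" if "1 \<le> i" "i \<le> r" for i
    unfolding xs_def using that by (rule list_subst_map)
  have f: "1 \<le> f i" "f i \<le> r" "f (f i) = i" if "1 \<le> i" "i \<le> r" for i
    using that by (auto simp: f_def)
  have gen: "generic_args xs"
    unfolding xs_def
  proof (rule generic_args_mapI[where ys = xs])
    show "rat_subst (list_subst xs) (- X (f i)) = X i" if "1 \<le> i" "i \<le> r" for i
      using f[OF that] by (simp add: rat_subst_poly_uminus subst)
  qed (simp_all add: xs_def)
  have len_xs: "length xs = r"
    by (simp add: xs_def)
  have step: "rat_subst (list_subst xs) (cyc M (word r j))
      = (- 1) ^ (r - 1) * cyc M (word r (r - Suc j))" if "j < r" for j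
  proof -
    let ?w = "word r (r - Suc j)"
    have w: "distinct (word r j)" "set (word r j) = {1..r}"
      using word_permutation[OF that] by auto
    have w': "distinct ?w" "set ?w = {1..r}"
      using word_permutation[of "r - Suc j" r] that by auto
    have len: "length ?w = r"
      using distinct_card[OF w'(1)] w'(2) by simp
    have "map f (word r j) = rev ?w"
    proof -
      have "map f [2..<j + 2] = rev [r - Suc j + 2..<r + 1]"
        using that by (intro nth_equalityI) (auto simp: f_def rev_nth simp del: upt_Suc)
      moreover have "map f [j + 2..<r + 1] = rev [2..<r - Suc j + 2]"
        using that by (intro nth_equalityI) (auto simp: f_def rev_nth simp del: upt_Suc)
      ultimately show ?thesis
        by (simp add: word_def f_def del: upt_Suc)
    qed
    moreover have "map (list_subst xs) (word r j) = map uminus (map X (map f (word r j)))"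
      using w(2) subst by (auto simp del: upt_Suc)
    ultimately have "map (list_subst xs) (word r j) @ [0] = map uminus (rev ([0] @ map X ?w))"
      by (simp add: rev_map del: upt_Suc)
    then have "rat_subst (list_subst xs) (cyc M (word r j))
        = mould_app M (rev (steps ([0] @ map X ?w)))"
      using rat_subst_cyc(1)[OF w gen len_xs, of M] by (simp only: steps_reflect)
    \<comment> \<open>The reflection leaves 0 at the front; push-invariance returns it to the end,
      and alternality undoes the reversal of the steps with the sign.\<close>
    moreover have "generic_args (steps ([0] @ map X ?w))"
      "mould_app M (steps ([0] @ map X ?w)) = cyc M ?w"
      using push_invariant_rotate[OF assms(2) generic_args_cyc[OF w']] assms(3) len
      by (simp_all add: cyc_def)
    moreover have "steps ([0] @ map X ?w) \<noteq> []"
      using len assms(3) by (simp add: steps_eq_Nil_iff)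
    ultimately show ?thesis
      using alternal_rev(1)[OF assms(1), of "steps ([0] @ map X ?w)"] len by simp
  qed
  have "rat_subst (list_subst xs) (\<Sum>j<r. cyc M (word r j))
      = (- 1) ^ (r - 1) * (\<Sum>j<r. cyc M (word r (r - Suc j)))"
    by (simp add: rat_subst_sum[OF gen] step sum_distrib_left del: upt_Suc)
  then show thesis
    using sum.nat_diff_reindex[of "\<lambda>j. cyc M (word r j)" r] by (intro that[OF gen]) simp
qed

subsection \<open>The Fay operator\<close>

lemma length_tails: "length (tails r) = r"
  by (simp add: tails_def)

definition fay_args :: "nat \<Rightarrow> nat \<Rightarrow> ratfun list" where
  "fay_args r i = map X [2..<i + 1] @ [- ubar i, ubar (i + 1)] @ map X [i + 2..<r + 1]"

lemma steps_ubar: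
  assumes "1 \<le> a" "a \<le> b"
  shows "steps (map (\<lambda>i. ubar r - ubar (i - 1)) [a..<Suc b]) = map X [a..<b]"
proof -
  have "ubar i - ubar (i - 1) = X i" if "a \<le> i" for i
    using that assms ubar_Suc[of "i - 1"] by simp
  then show ?thesis
    using assms steps_map_upt[of "\<lambda>i. ubar r - ubar (i - 1)" a "b - a"] by (simp del: upt_Suc)
qed

text \<open>Up to translation, \<open>tails\<close> sends the variables \<open>X i\<close> to the points \<open>- ubar (i - 1)\<close>, whose
  successive differences are the \<open>X i\<close>; inserting \<open>X 1\<close> elsewhere produces the arguments of the
  Fay operator.\<close>
lemma steps_tails_word:
  assumes "j < r"
  shows "steps (map (list_subst (tails r)) (word r j) @ [0])
    = (if j = 0 then map X [1..<r + 1] else fay_args r j)"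
proof -
  \<comment> \<open>The tail \<open>u_i + ... + u_r\<close>; its value 0 at \<open>i = r + 1\<close>
    is the final point.\<close>
  define q where "q i = ubar r - ubar (i - 1)" for i
  note steps_q = steps_ubar[where r = r, folded q_def]
  have "map (list_subst (tails r)) (word r j) = map q (word r j)"
    using word_permutation[OF assms] by (auto simp: q_def list_subst_tails simp del: upt_Suc)
  moreover have "0 = q (r + 1)"
    by (simp add: q_def)
  ultimately have "map (list_subst (tails r)) (word r j) @ [0]
      = map q [2..<j + 2] @ q 1 # map q [j + 2..<Suc (r + 1)]"
    using assms by (simp add: word_def)
  moreover have "steps (map q [2..<j + 2] @ q 1 # map q [j + 2..<Suc (r + 1)])
      = (if j = 0 then map X [1..<r + 1] else fay_args r j)"
  proof (cases "j = 0")
    case True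
    have "q 1 # map q [2..<Suc (r + 1)] = map q [1..<Suc (r + 1)]"
      using upt_conv_Cons[of 1 "Suc (r + 1)"] by (simp add: numeral_2_eq_2 del: upt_Suc)
    then show ?thesis
      using True steps_q[of 1 "r + 1"] by (simp add: numeral_2_eq_2 del: upt_Suc)
  next
    case False
    \<comment> \<open>The displaced point \<open>q 1\<close> follows \<open>q (j + 1)\<close> and
      precedes \<open>q (j + 2)\<close>; the two differences are the special arguments
      \<open>- ubar j\<close> and \<open>ubar (j + 1)\<close>.\<close>
    have "steps (map q [2..<j + 2] @ [q 1]) = map X [2..<j + 1] @ [- ubar j]"
    proof -
      have "[2..<j + 2] = [2..<j + 1] @ [j + 1]"
        using False by simp
      then show ?thesis
        using False steps_q[of 2 "j + 1"] steps_snoc2[of "map q [2..<j + 1]" "q (j + 1)" "q 1"]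
        by (simp add: q_def[of "Suc 0"] q_def[of "Suc j"] del: upt_Suc)
    qed
    moreover have "steps (q 1 # map q [j + 2..<Suc (r + 1)]) = ubar (j + 1) # map X [j + 2..<r + 1]"
    proof -
      have "[j + 2..<Suc (r + 1)] = (j + 2) # [j + 3..<Suc (r + 1)]"
        using assms upt_conv_Cons[of "j + 2" "Suc (r + 1)"] by (simp add: numeral_3_eq_3 del: upt_Suc)
      then show ?thesis
        using assms steps_q[of "j + 2" "r + 1"]
        by (simp add: q_def[of "Suc 0"] q_def[of "Suc (Suc j)"] del: upt_Suc)
    qed
    ultimately show ?thesis
      using False steps_append[of "map q [2..<j + 2]" "q 1" "map q [j + 2..<Suc (r + 1)]"]
      by (simp add: fay_args_def del: upt_Suc)
  qed
  ultimately show ?thesis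
    by simp
qed

lemma generic_args_fay:
  assumes "1 \<le> i" "i < r"
  shows "generic_args (fay_args r i)"
    and "mould_app M (fay_args r i) = rat_subst (list_subst (tails r)) (cyc M (word r i))"
proof -
  have w: "distinct (word r i)" "set (word r i) = {1..r}"
    using word_permutation[OF assms(2)] by auto
  note cyc = rat_subst_cyc[OF w generic_args_tails length_tails]
  show "generic_args (fay_args r i)"
    using cyc(2) steps_tails_word[OF assms(2)] assms by simp
  show "mould_app M (fay_args r i) = rat_subst (list_subst (tails r)) (cyc M (word r i))"
    using cyc(1)[of M] steps_tails_word[OF assms(2)] assms by simp
qed

lemma sum_list_map_X: "sum_list (map X [a..<b]) = (\<Sum>i\<in>{a..<b}. X i)"
  by (simp add: sum_list_distinct_conv_sum_set)

text \<open>The entries \<open>- ubar i\<close> and \<open>ubar (i + 1)\<close> add up to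
  \<open>X (i + 1)\<close>. So the sum is the same for all \<open>i\<close> and becomes a common
  factor of these Fay summands.\<close>

lemma sum_list_fay_args:
  assumes "1 \<le> i" "i < r"
  shows "sum_list (fay_args r i) = (\<Sum>k=2..r. X k)"
proof -
  have "{2..r} = {2..<i + 1} \<union> {i + 1} \<union> {i + 2..<r + 1}"
    using assms by auto
  then have "(\<Sum>k=2..r. X k) = (\<Sum>k\<in>{2..<i + 1}. X k) + X (i + 1) + (\<Sum>k\<in>{i + 2..<r + 1}. X k)"
    by (simp add: sum.union_disjoint)
  then show ?thesis
    by (simp add: fay_args_def sum_list_map_X ubar_Suc del: upt_Suc)
qed

lemma ubar_split:
  assumes "r \<ge> 1"
  shows "ubar r = X 1 + (\<Sum>k=2..r. X k)"
  using assms by (simp add: ubar_def sum.atLeast_Suc_atMost numeral_2_eq_2)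

lemma mould_app_depth_div_Delta:
  assumes "M \<in> ARI" "generic_args xs"
  shows "mould_app (depth_div (Delta M)) xs = sum_list xs * mould_app M xs"
proof -
  have "rat_subst (list_subst xs) (\<Sum>i=1..length xs. X i)
      = sum_list (map (list_subst xs) [1..<length xs + 1])"
    by (simp add: rat_subst_poly_sum sum_list_distinct_conv_sum_set
        atLeastLessThanSuc_atLeastAtMost del: upt_Suc)
  also have "\<dots> = sum_list xs"
    by (simp only: map_list_subst)
  finally show ?thesis
    using assms by (simp add: mould_app_alt depth_div_Delta rat_subst_mult)
qed

text \<open>The summands over \<open>i\<close> are the insertions with \<open>j = i\<close>, each
  with the factor \<open>u_2 + ... + u_r\<close>. The other two terms are
  \<open>ubar r * M r\<close> and \<open>- X 1 * M r\<close>; together they form the missing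
  insertion \<open>j = 0\<close> with the same factor.\<close>

lemma fay_depth_div_Delta:
  assumes "M \<in> ARI" "push_invariant M" "r \<ge> 1"
  shows "fay (depth_div (Delta M)) r
    = (\<Sum>k=2..r. X k) * rat_subst (list_subst (tails r)) (\<Sum>j<r. cyc M (word r j))"
proof -
  let ?B = "depth_div (Delta M)" and ?S = "\<Sum>k=2..r. X k"
  let ?R = "rat_subst (list_subst (tails r))"
  let ?L = "map X [2..<r + 1] @ [- ubar r]"
  have upt: "[1..<r + 1] = 1 # [2..<r + 1]"
    using assms(3) upt_conv_Cons[of 1 "r + 1"] by (simp add: numeral_2_eq_2)
  \<comment> \<open>These arguments arise from \<open>X 1, ..., X r\<close> by moving the first
    point \<open>q 1\<close> to the end of the cyclic word.\<close>
  have L: "mould_app M ?L = M r" "generic_args ?L"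
  proof -
    define q where "q i = ubar r - ubar (i - 1)" for i
    note steps_q = steps_ubar[where r = r, folded q_def]
    have "steps ([q 1] @ map q [2..<r + 2]) = map X [1..<r + 1]"
    proof -
      have "[q 1] @ map q [2..<r + 2] = map q [1..<Suc (r + 1)]"
        using upt_conv_Cons[of 1 "Suc (r + 1)"] by (simp add: numeral_2_eq_2 del: upt_Suc)
      then show ?thesis
        using steps_q[of 1 "r + 1"] by (simp only:)
    qed
    moreover have "steps (map q [2..<r + 2] @ [q 1]) = ?L"
    proof -
      have "map q [2..<r + 2] = map q [2..<r + 1] @ [q (r + 1)]"
        using assms(3) by simp
      then show ?thesis
        using steps_snoc2[of "map q [2..<r + 1]" "q (r + 1)" "q 1"] steps_q[of 2 "r + 1"] assms(3)
        by (simp add: q_def[of "Suc 0"] q_def[of "Suc r"] del: upt_Suc)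
    qed
    ultimately show "mould_app M ?L = M r" "generic_args ?L"
      using push_invariant_rotate[OF assms(2), of "[q 1]" "map q [2..<r + 2]"] generic_args_X[of r]
        mould_app_X[of M r] assms(3)
      by (simp_all del: upt_Suc)
  qed
  have B_L: "mould_app ?B ?L = - X 1 * M r"
  proof -
    have "sum_list ?L = - X 1"
      using ubar_split[OF assms(3)]
      by (simp add: sum_list_map_X atLeastLessThanSuc_atLeastAtMost del: upt_Suc)
    then show ?thesis
      using mould_app_depth_div_Delta[OF assms(1) L(2)] by (simp only: L(1))
  qed
  have B_r: "?B r = ubar r * M r"
    by (simp add: depth_div_Delta[OF assms(1)] ubar_def)
  have B_fay: "mould_app ?B (fay_args r i) = ?S * ?R (cyc M (word r i))"
    if "i \<in> {1..r - 1}" for i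
  proof -
    have "1 \<le> i" "i < r"
      using that assms(3) by auto
    then show ?thesis
      using mould_app_depth_div_Delta[OF assms(1) generic_args_fay(1)]
      by (simp add: generic_args_fay(2) sum_list_fay_args)
  qed
  have "fay ?B r = ?S * (M r + (\<Sum>i=1..r - 1. ?R (cyc M (word r i))))"
  proof -
    have "fay ?B r = ?B r + mould_app ?B ?L + (\<Sum>i=1..r - 1. mould_app ?B (fay_args r i))"
      using assms(3) by (simp add: fay_def fay_args_def del: upt_Suc)
    also have "\<dots> = ubar r * M r - X 1 * M r + (\<Sum>i=1..r - 1. ?S * ?R (cyc M (word r i)))"
      by (simp only: B_L B_r B_fay cong: sum.cong) simp
    finally show ?thesis
      using ubar_split[OF assms(3)] by (simp add: sum_distrib_left algebra_simps)
  qed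
  also have "M r = ?R (cyc M (word r 0))"
  proof -
    have w: "distinct (word r 0)" "set (word r 0) = {1..r}"
      using word_permutation[of 0 r] assms(3) by auto
    show ?thesis
      using rat_subst_cyc(1)[OF w generic_args_tails length_tails, of M] assms(3)
        steps_tails_word[of 0 r] mould_app_X[of M r]
      by (simp del: upt_Suc)
  qed
  also have "?R (cyc M (word r 0)) + (\<Sum>i=1..r - 1. ?R (cyc M (word r i)))
      = (\<Sum>j<r. ?R (cyc M (word r j)))"
  proof -
    have "{..<r} = insert 0 {1..r - 1}"
      using assms(3) by auto
    then show ?thesis
      by simp
  qed
  finally show ?thesis
    by (simp add: rat_subst_sum[OF generic_args_tails])
qed

section \<open>Equivalence of the three conditions\<close>

lemma const_of_nat: "const (of_nat n) = of_nat n"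
  by (induction n) (simp_all add: const_add)

lemma const_uminus: "const (- k) = - const k"
  using const_add[of k "- k"] by (simp add: eq_neg_iff_add_eq_0 add.commute)

theorem theorem1p3:
  fixes M A A' :: mould and c :: "nat \<Rightarrow> rat"
  assumes "M \<in> ARI_Delta"
    and "alternal M"
    and "push_invariant M"
    and "A = Delta M"
    and "A' = depth_div A"
  shows "(first_alternality (mould_add (swap M) (const_mould c))
            \<longleftrightarrow> circ_neutral (mould_add (swap M) (const_mould c)))
       \<and> (circ_neutral (mould_add (swap M) (const_mould c))
            \<longleftrightarrow> (\<forall>r\<ge>2. fay A' r = - (of_nat r * const (c r) * (\<Sum>i=2..r. X i))))"
proof -
  define T where "T r = (\<Sum>j<r. cyc M (word r j))" for r
  define T' where "T' r = (\<Sum>k<r. cyc M (rotate k [1..<r + 1]))" for r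
  \<comment> \<open>The equivalences hold in each depth \<open>r\<close> separately.\<close>
  have "((- 1) ^ (r - 1) * T r = - (of_nat r * const (c r))
        \<longleftrightarrow> (- 1) ^ (r - 1) * T' r = - (of_nat r * const (c r)))
      \<and> (fay A' r = - (of_nat r * const (c r) * (\<Sum>i=2..r. X i))
        \<longleftrightarrow> (- 1) ^ (r - 1) * T r = - (of_nat r * const (c r)))" if "r \<ge> 2" for r
  proof
    define K where "K = - (of_nat r * c r)"
    have K: "- (of_nat r * const (c r)) = const K"
      by (simp add: K_def const_uminus const_mult const_of_nat)
    have r: "r \<ge> 1"
      using that by simp
    obtain xs where xs: "generic_args xs" "rat_subst (list_subst xs) (T r) = T' r"
      by (rule circ_sum_eq[OF assms(3) r, folded T_def T'_def])
    \<comment> \<open>The substitution taking \<open>T r\<close> to \<open>T' r\<close> is injective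
      and fixes constants, so both sums are compared with the same constant.\<close>
    have "(- 1) ^ (r - 1) * T r = const K
        \<longleftrightarrow> rat_subst (list_subst xs) ((- 1) ^ (r - 1) * T r) = rat_subst (list_subst xs) (const K)"
      by (rule rat_subst_eq_iff[OF xs(1), symmetric])
    then show "(- 1) ^ (r - 1) * T r = - (of_nat r * const (c r))
        \<longleftrightarrow> (- 1) ^ (r - 1) * T' r = - (of_nat r * const (c r))"
      by (simp add: K rat_subst_sign_mult xs)
    obtain ys where ys: "generic_args ys" "rat_subst (list_subst ys) (T r) = (- 1) ^ (r - 1) * T r"
      by (rule insertion_sum_reflect[OF assms(2,3) r, folded T_def])
    \<comment> \<open>The reflection multiplies \<open>T r\<close> by the sign and fixes constants.
      Applied to either equation, it yields the other.\<close>
    have sign: "(- 1) ^ (r - 1) * T r = const K \<longleftrightarrow> T r = const K"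
    proof
      assume "T r = const K"
      with ys(2) show "(- 1) ^ (r - 1) * T r = const K"
        by (simp only: rat_subst_const)
    next
      assume "(- 1) ^ (r - 1) * T r = const K"
      then have "rat_subst (list_subst ys) ((- 1) ^ (r - 1) * T r) = const K"
        by simp
      then show "T r = const K"
        by (simp add: rat_subst_sign_mult ys)
    qed
    let ?S = "\<Sum>i=2..r. X i"
    have "?S \<noteq> 0"
    proof -
      \<comment> \<open>The factor \<open>?S\<close> is the second tail, hence the image of a
        variable under a generic substitution. Being nonzero, it can be cancelled in the Fay
        relation.\<close>
      have "rat_subst (list_subst (tails r)) (X 2) = ?S"
        using that ubar_split[of r] by (simp add: list_subst_tails ubar_Suc numeral_2_eq_2[symmetric] ubar_def)
      then show ?thesis
        using rat_subst_eq_0_iff[OF generic_args_tails, of r "X 2"] by simp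
    qed
    moreover have "fay A' r = ?S * rat_subst (list_subst (tails r)) (T r)"
      using fay_depth_div_Delta[of M r] assms that by (simp add: ARI_Delta_def T_def)
    moreover have "- (of_nat r * const (c r) * ?S) = ?S * const K"
      using K by (metis minus_mult_left mult.commute)
    ultimately have "fay A' r = - (of_nat r * const (c r) * ?S)
        \<longleftrightarrow> rat_subst (list_subst (tails r)) (T r) = rat_subst (list_subst (tails r)) (const K)"
      by simp
    then show "fay A' r = - (of_nat r * const (c r) * ?S)
        \<longleftrightarrow> (- 1) ^ (r - 1) * T r = - (of_nat r * const (c r))"
      by (simp only: rat_subst_eq_iff[OF generic_args_tails] K sign)
  qed
  then show ?thesis
    unfolding first_alternality_iff[OF assms(2)] circ_neutral_iff[OF assms(2)] T_def T'_def by blast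
qed

end
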